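(* Let $j\ge 2$ be an integer and let $b_{j,m}$ ($m\ge 1$) be the Laurent coefficients of the inverse $\Psi_j$ of the normalized exterior conformal map of the Multibrot set $M_j$. Then for every integer $M\ge 1$, $$\operatorname{Area}(M_j)\le U_{j,M},\qquad\text{where}\qquad U_{j,M}=\pi\left(1-\sum_{m=1}^{M}m\,|b_{j,m}|^2\right).$$
   Context: For an integer $j\ge2$ and $c\in\mathbb C$ define $z_0(c)=0$ and $z_{n+1}(c)=z_n(c)^j+c$ for $n\ge 0$. The Multibrot set of degree $j$ is $M_j=\{c\in\mathbb C: (z_n(c))_{n\ge 0}\text{ is bounded}\}$. Let $\Phi_j:\widehat{\mathbb C}\setminus M_j\to\{w:|w|>1\}$ (the target including $\infty$) be the normalized exterior conformal map, i.e. the conformal isomorphism with $\Phi_j(\infty)=\infty$ and $\Phi_j(c)/c\to 1$ as $c\to\infty$, and let $\Psi_j=\Phi_j^{-1}$. Near infinity $\Psi_j$ has the Laurent expansion $$\Psi_j(w)=w+b_{j,0}+\sum_{m=1}^{\infty}\frac{b_{j,m}}{w^m},$$ which defines the coefficients $b_{j,m}$. $\operatorname{Area}$ denotes two-dimensional Lebesgue measure on $\mathbb C\cong\mathbb R^2$. *)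

theory Defs
  imports "HOL-Complex_Analysis.Complex_Analysis"
begin

primrec multibrot_orbit :: "nat \<Rightarrow> complex \<Rightarrow> nat \<Rightarrow> complex" where
  "multibrot_orbit j c 0 = 0"
| "multibrot_orbit j c (Suc n) = multibrot_orbit j c n ^ j + c"

definition multibrot :: "nat \<Rightarrow> complex set" where
  "multibrot j = {c. bounded (range (multibrot_orbit j c))}"

(* The maps live on the finite part of the Riemann sphere. A conformal isomorphism of
   the complement of the Multibrot set in the sphere onto the exterior of the closed unit disc
   (with infinity) that fixes infinity is the same thing as a holomorphic bijection of the
   finite parts that tends to infinity at infinity: 1/Phi(1/z) then has a removable
   singularity at 0. *)
definition normalized_exterior_map :: "nat \<Rightarrow> (complex \<Rightarrow> complex) \<Rightarrow> bool" where
  "normalized_exterior_map j \<Phi> \<longleftrightarrow>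
     \<Phi> holomorphic_on (- multibrot j) \<and>
     bij_betw \<Phi> (- multibrot j) {w. 1 < norm w} \<and>
     filterlim \<Phi> at_infinity at_infinity \<and>
     ((\<lambda>c. \<Phi> c / c) \<longlongrightarrow> 1) at_infinity"

(* Psi(w) = w + b 0 + b 1 / w + b 2 / w^2 + ... for all w of sufficiently large modulus;
   this determines b. *)
definition laurent_coeffs_at_infinity :: "(complex \<Rightarrow> complex) \<Rightarrow> (nat \<Rightarrow> complex) \<Rightarrow> bool" where
  "laurent_coeffs_at_infinity \<Psi> b \<longleftrightarrow>
     (\<forall>\<^sub>F w in at_infinity. (\<lambda>m. b m / w ^ m) sums (\<Psi> w - w))"

end

theory Submission
  imports Defs
begin

text \<open>
  The bound is Gronwall's area theorem for the exterior map \<open>\<Psi>\<close> of a compact set \<open>K\<close>. The classical proof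
  computes the area inside the image of the circle \<open>norm w = R\<close> by Green's theorem and lets \<open>R\<close> tend to 1. The proof
  below goes out to infinity instead and compares areas of plane sets.

  The set \<open>K\<close> and the image under \<open>\<Psi>\<close> of the annulus \<open>1 < norm w < R\<close> are disjoint, so
  their areas add up to at most the area of any set that contains both.
  For large \<open>R\<close> the image of the circle \<open>norm w = R\<close> is within \<open>O(1 / R\<^sup>2)\<close> of the image under \<open>w + b 0 + b 1 / w\<close>,
  which is an ellipse, so that \<open>K\<close> and the image of the annulus lie in a slightly larger ellipse
  (\<open>complement_exterior_image_subset\<close>) of area at most \<open>pi * R\<^sup>2 + O(1 / R)\<close> (\<open>measure_ellipse\<close>).
  On the other hand the image of the annulus has area at least
  \<open>pi * (R\<^sup>2 - 1 + (\<Sum>m = 1..M. m * (norm (b m))\<^sup>2 * (1 - R powr (- 2 * m))))\<close>: this is the integral of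
  \<open>(norm (deriv \<Psi> w))\<^sup>2\<close>, to which the terms of the Laurent series contribute separately by orthogonality
  (\<open>area_exp_power_series\<close>, applied to annuli \<open>exp a < norm w < R\<close> with \<open>a > 0\<close>). Subtracting and letting \<open>R\<close> tend to infinity gives
  \<open>exterior_area_theorem\<close>.

  For the Multibrot set it remains to see that it is compact (\<open>compact_multibrot\<close>) and that the Laurent series,
  given near infinity only, represents \<open>\<Psi>\<close> for all \<open>norm w > 1\<close> (\<open>laurent_series_exterior\<close>).
\<close>

section \<open>Change of variables in the complex plane\<close>

text \<open>
  The change of variables formula for injective differentiable maps lives on \<open>real ^ 'n\<close>, and iterated
  integrals live on products. Both are carried over to the complex plane by
  coordinate maps that take the standard basis to the standard basis: such a map pulls boxes
  back to boxes of the same side lengths, so it preserves Lebesgue measure.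
\<close>

lemma lborel_distr_basis_iso:
  fixes v :: "'a::euclidean_space \<Rightarrow> 'b::euclidean_space"
  assumes lin: "linear v" and bij: "bij_betw v Basis Basis"
    and inner: "\<And>x b. b \<in> Basis \<Longrightarrow> v x \<bullet> v b = x \<bullet> b"
  shows "distr lborel borel v = lborel"
proof -
  have [measurable]: "v \<in> borel_measurable borel"
    using lin by (simp add: borel_measurable_continuous_onI linear_continuous_on linear_conv_bounded_linear)
  have img: "v ` Basis = Basis"
    using bij by (simp add: bij_betw_def)
  show ?thesis
  proof (rule lborel_eqI[symmetric])
    fix l u :: 'b
    assume lu: "\<And>b. b \<in> Basis \<Longrightarrow> l \<bullet> b \<le> u \<bullet> b"
    define w :: "'b \<Rightarrow> 'a" where "w y = (\<Sum>b\<in>Basis. (y \<bullet> v b) *\<^sub>R b)" for y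
    have w: "w y \<bullet> b = y \<bullet> v b" if "b \<in> Basis" for y b
      using that by (simp add: w_def)
    have vb: "v b \<in> Basis" if "b \<in> Basis" for b
      using img that by blast
    have "v -` box l u = {x. \<forall>b\<in>v ` Basis. l \<bullet> b < v x \<bullet> b \<and> v x \<bullet> b < u \<bullet> b}"
      by (auto simp: box_def img)
    also have "\<dots> = box (w l) (w u)"
      by (auto simp: box_def inner w)
    finally have pre: "v -` box l u = box (w l) (w u)" .
    have "emeasure (distr lborel borel v) (box l u) = emeasure lborel (box (w l) (w u))"
      by (simp add: emeasure_distr pre)
    also have "\<dots> = ennreal (\<Prod>b\<in>Basis. (w u - w l) \<bullet> b)"
      by (rule emeasure_lborel_box) (simp add: w lu vb)
    also have "(\<Prod>b\<in>Basis. (w u - w l) \<bullet> b) = (\<Prod>b\<in>Basis. (u - l) \<bullet> v b)"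
      by (rule prod.cong) (simp_all add: w inner_diff_left)
    also have "\<dots> = (\<Prod>b\<in>Basis. (u - l) \<bullet> b)"
      by (rule prod.reindex_bij_betw[OF bij])
    finally show "emeasure (distr lborel borel v) (box l u) = ennreal (\<Prod>b\<in>Basis. (u - l) \<bullet> b)" .
  qed simp
qed

definition complex_of_vec :: "real^2 \<Rightarrow> complex" where
  "complex_of_vec x = Complex (x $ 1) (x $ 2)"

definition vec_of_complex :: "complex \<Rightarrow> real^2" where
  "vec_of_complex z = vector [Re z, Im z]"

lemma vec_of_complex_nth [simp]: "vec_of_complex z $ 1 = Re z" "vec_of_complex z $ 2 = Im z"
  by (simp_all add: vec_of_complex_def)

lemma complex_of_vec_inverse [simp]: "vec_of_complex (complex_of_vec x) = x"
  by (simp add: complex_of_vec_def vec_eq_iff forall_2)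

lemma vec_of_complex_inverse [simp]: "complex_of_vec (vec_of_complex z) = z"
  by (simp add: complex_of_vec_def)

lemma linear_complex_of_vec: "linear complex_of_vec"
  by (rule linearI) (simp_all add: complex_of_vec_def complex_eq_iff)

lemma linear_vec_of_complex: "linear vec_of_complex"
  by (rule linearI) (simp_all add: vec_eq_iff forall_2)

lemma distr_complex_of_vec: "distr lborel borel complex_of_vec = lborel"
proof (rule lborel_distr_basis_iso[OF linear_complex_of_vec])
  have B: "(Basis :: (real^2) set) = {axis 1 1, axis 2 1}"
    by (auto simp: Basis_vec_def UNIV_2)
  have v: "complex_of_vec (axis 1 1) = 1" "complex_of_vec (axis 2 1) = \<i>"
    by (simp_all add: complex_of_vec_def complex_eq_iff axis_def)
  show "bij_betw complex_of_vec Basis Basis"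
    unfolding B Basis_complex_def bij_betw_def inj_on_def by (simp add: v complex_eq_iff)
  fix x b :: "real^2" assume "b \<in> Basis"
  then show "complex_of_vec x \<bullet> complex_of_vec b = x \<bullet> b"
    by (auto simp: B v inner_complex_def complex_of_vec_def inner_vec_def sum_2 axis_def)
qed

lemma distr_Complex: "distr lborel borel (\<lambda>(x, y). Complex x y) = lborel"
proof (rule lborel_distr_basis_iso)
  show "linear (\<lambda>(x, y). Complex x y)"
    by (rule linearI) (auto simp: complex_eq_iff)
  have B: "(Basis :: (real \<times> real) set) = {(1,0), (0,1)}"
    by (auto simp: Basis_prod_def)
  show "bij_betw (\<lambda>(x, y). Complex x y) Basis Basis"
    unfolding B Basis_complex_def bij_betw_def inj_on_def by (auto simp: complex_eq_iff)
  fix x b :: "real \<times> real" assume "b \<in> Basis"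
  then show "(case x of (x, y) \<Rightarrow> Complex x y) \<bullet> (case b of (x, y) \<Rightarrow> Complex x y) = x \<bullet> b"
    by (auto simp: B inner_complex_def split: prod.splits)
qed

lemma complex_of_vec_borel [measurable]: "complex_of_vec \<in> borel_measurable borel"
  using linear_complex_of_vec
  by (simp add: borel_measurable_continuous_onI linear_continuous_on linear_conv_bounded_linear)

lemma vimage_complex_of_vec: "complex_of_vec -` S = vec_of_complex ` S"
  by (force simp: image_iff)

lemma vec_of_complex_borel_sets: "S \<in> sets borel \<Longrightarrow> vec_of_complex ` S \<in> sets borel"
  using measurable_sets[OF complex_of_vec_borel, of S] by (simp add: vimage_complex_of_vec)

lemma measure_vec_of_complex:
  assumes "S \<in> sets borel"
  shows "measure lborel (vec_of_complex ` S) = measure lborel S"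
proof -
  have "measure lborel S = measure (distr lborel borel complex_of_vec) S"
    by (simp add: distr_complex_of_vec)
  also have "\<dots> = measure lborel (vec_of_complex ` S)"
    using assms by (subst measure_distr) (simp_all add: vimage_complex_of_vec)
  finally show ?thesis ..
qed

text \<open>
  Every real-linear map of the plane is \<open>h \<mapsto> a * h + c * cnj h\<close>. Writing derivatives in this form
  covers holomorphic maps (\<open>c = 0\<close>) and the affine map onto an ellipse alike.
\<close>

lemma det_real_linear_complex:
  "det (matrix (vec_of_complex \<circ> (\<lambda>h. a * h + c * cnj h) \<circ> complex_of_vec)) = (norm a)\<^sup>2 - (norm c)\<^sup>2"
  unfolding det_2 cmod_power2
  by (simp add: matrix_def complex_of_vec_def axis_def algebra_simps power2_eq_square)

lemma measure_complex_image_eq: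
  assumes S: "S \<in> sets borel" and fS: "f ` S \<in> sets borel"
    and der: "\<And>z. z \<in> S \<Longrightarrow> (f has_derivative (\<lambda>h. a z * h + c z * cnj h)) (at z within S)"
    and inj: "inj_on f S"
    and int: "set_integrable lborel S (\<lambda>z. \<bar>(norm (a z))\<^sup>2 - (norm (c z))\<^sup>2\<bar>)"
  shows "measure lebesgue (f ` S) = (LINT z:S|lborel. \<bar>(norm (a z))\<^sup>2 - (norm (c z))\<^sup>2\<bar>)"
proof -
  define J where "J z = \<bar>(norm (a z))\<^sup>2 - (norm (c z))\<^sup>2\<bar>" for z
  define g where "g = vec_of_complex \<circ> f \<circ> complex_of_vec"
  define g' where "g' x = vec_of_complex \<circ> (\<lambda>h. a (complex_of_vec x) * h + c (complex_of_vec x) * cnj h)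
    \<circ> complex_of_vec" for x
  let ?T = "vec_of_complex ` S"
  have ind: "indicator ?T x = (indicator S (complex_of_vec x) :: real)" for x
    by (auto simp: indicator_def image_iff) (metis complex_of_vec_inverse)
  have det: "\<bar>det (matrix (g' x))\<bar> = J (complex_of_vec x)" for x
    by (simp add: g'_def det_real_linear_complex J_def)
  have bm: "(\<lambda>z. indicator S z * J z) \<in> borel_measurable borel"
    using borel_measurable_integrable[OF int[unfolded set_integrable_def]] by (simp add: J_def)
  have iT: "set_integrable lborel ?T (\<lambda>x. J (complex_of_vec x))"
  proof -
    have "integrable (distr lborel borel complex_of_vec) (\<lambda>z. indicator S z * J z)"
      using int by (simp add: distr_complex_of_vec set_integrable_def J_def)
    then have "integrable lborel (\<lambda>x. indicator S (complex_of_vec x) * J (complex_of_vec x))"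
      by (subst (asm) integrable_distr_eq) (use bm in simp_all)
    then show ?thesis
      by (simp add: set_integrable_def ind)
  qed
  have LT: "(LINT x:?T|lborel. J (complex_of_vec x)) = (LINT z:S|lborel. J z)"
  proof -
    have "(LINT z:S|lborel. J z) = integral\<^sup>L (distr lborel borel complex_of_vec) (\<lambda>z. indicator S z * J z)"
      by (simp add: set_lebesgue_integral_def distr_complex_of_vec)
    also have "\<dots> = (LINT x|lborel. indicator S (complex_of_vec x) * J (complex_of_vec x))"
      by (rule integral_distr) (use bm in simp_all)
    finally show ?thesis
      by (simp add: set_lebesgue_integral_def ind)
  qed
  have blV: "bounded_linear complex_of_vec" "bounded_linear vec_of_complex"
    using linear_complex_of_vec linear_vec_of_complex by (simp_all add: linear_conv_bounded_linear)
  have "measure lebesgue (g ` ?T) = integral ?T (\<lambda>x. \<bar>det (matrix (g' x))\<bar>)"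
  proof (rule measure_differentiable_image_eq)
    show "?T \<in> sets lebesgue"
      using vec_of_complex_borel_sets[OF S] by simp
    show "inj_on g ?T"
      using inj unfolding g_def inj_on_def
      by (metis comp_apply complex_of_vec_inverse image_iff vec_of_complex_inverse)
    show "(\<lambda>x. \<bar>det (matrix (g' x))\<bar>) integrable_on ?T"
      unfolding det using set_borel_integral_eq_integral(1)[OF iT] .
    fix x assume x: "x \<in> ?T"
    then have "complex_of_vec x \<in> S" by auto
    from der[OF this]
    have "(f has_derivative (\<lambda>h. a (complex_of_vec x) * h + c (complex_of_vec x) * cnj h))
       (at (complex_of_vec x) within complex_of_vec ` ?T)"
      by (simp add: image_comp o_def)
    from diff_chain_within[OF bounded_linear_imp_has_derivative[OF blV(1)] this]
    have "(f \<circ> complex_of_vec has_derivative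
      (\<lambda>h. a (complex_of_vec x) * h + c (complex_of_vec x) * cnj h) \<circ> complex_of_vec) (at x within ?T)" .
    from diff_chain_within[OF this bounded_linear_imp_has_derivative[OF blV(2)]]
    show "(g has_derivative g' x) (at x within ?T)"
      by (simp add: g_def g'_def o_assoc)
  qed
  also have "\<dots> = (LINT x:?T|lborel. J (complex_of_vec x))"
    unfolding det using set_borel_integral_eq_integral(2)[OF iT] ..
  also have "\<dots> = (LINT z:S|lborel. J z)" by (rule LT)
  finally have "measure lebesgue (g ` ?T) = (LINT z:S|lborel. J z)" .
  moreover have "g ` ?T = vec_of_complex ` f ` S"
    by (auto simp: g_def image_comp o_def)
  ultimately have "measure lebesgue (vec_of_complex ` f ` S) = (LINT z:S|lborel. J z)"
    by simp
  then show ?thesis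
    using measure_vec_of_complex[OF fS] fS vec_of_complex_borel_sets[OF fS]
    by (simp add: J_def)
qed

section \<open>Orthogonality of exponentials on a strip of height \<open>2 * pi\<close>\<close>

lemma complex_box_integral:
  fixes G :: "complex \<Rightarrow> real"
  assumes G: "continuous_on (cbox p q) G"
  shows "set_integrable lborel (box p q) G"
    and "(LINT z:box p q|lborel. G z) = integral (cbox p q) G"
    and "integral (cbox p q) G = integral {Re p..Re q} (\<lambda>x. integral {Im p..Im q} (\<lambda>y. G (Complex x y)))"
proof -
  have ic: "set_integrable lborel (cbox p q) G"
    using borel_integrable_compact[OF compact_cbox G] by (simp add: set_integrable_def)
  show ib: "set_integrable lborel (box p q) G"
    by (rule set_integrable_subset[OF ic]) (auto simp: box_subset_cbox)
  show "(LINT z:box p q|lborel. G z) = integral (cbox p q) G"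
    using set_borel_integral_eq_integral(2)[OF ib] integral_open_interval by metis
  let ?C = "\<lambda>(x, y). Complex x y"
  let ?Q = "cbox (Re p, Im p) (Re q, Im q)"
  have ind: "indicator (cbox p q) (?C w) = (indicator ?Q w :: real)" for w
    by (cases w) (auto simp: indicator_def in_cbox_complex_iff)
  have contC: "continuous_on A ?C" for A
    by (auto simp: case_prod_unfold Complex_eq intro!: continuous_intros)
  have CQ: "?C w \<in> cbox p q" if "w \<in> ?Q" for w
    using that by (cases w) (auto simp: in_cbox_complex_iff)
  have GC: "continuous_on ?Q (\<lambda>w. G (?C w))"
    by (rule continuous_on_compose2[OF G contC]) (use CQ in auto)
  have iQ: "set_integrable lborel ?Q (\<lambda>w. G (?C w))"
    using borel_integrable_compact[OF compact_cbox GC] by (simp add: set_integrable_def)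
  have "integral (cbox p q) G = (LINT z:cbox p q|lborel. G z)"
    using set_borel_integral_eq_integral(2)[OF ic] ..
  also have "\<dots> = integral\<^sup>L (distr lborel borel ?C) (\<lambda>z. indicator (cbox p q) z * G z)"
    by (simp only: set_lebesgue_integral_def distr_Complex real_scaleR_def)
  also have "\<dots> = (LINT w|lborel. indicator (cbox p q) (?C w) * G (?C w))"
  proof (rule integral_distr)
    show "?C \<in> borel_measurable lborel"
      using borel_measurable_continuous_onI[OF contC] by simp
    show "(\<lambda>z. indicator (cbox p q) z * G z) \<in> borel_measurable borel"
      using borel_measurable_integrable[OF ic[unfolded set_integrable_def]] by simp
  qed
  also have "\<dots> = (LINT w:?Q|lborel. G (?C w))"
    by (simp add: set_lebesgue_integral_def ind)
  also have "\<dots> = integral ?Q (\<lambda>w. G (?C w))"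
    by (rule set_borel_integral_eq_integral(2)[OF iQ])
  also have "\<dots> = integral (cbox (Re p) (Re q)) (\<lambda>x. integral (cbox (Im p) (Im q)) (\<lambda>y. G (Complex x y)))"
    using integral_prod_continuous[OF GC] by simp
  finally show "integral (cbox p q) G = integral {Re p..Re q} (\<lambda>x. integral {Im p..Im q} (\<lambda>y. G (Complex x y)))"
    by simp
qed

lemma has_integral_exp_int_period:
  "((\<lambda>y. exp (\<i> * of_int k * complex_of_real y)) has_integral (if k = 0 then 2 * pi else 0)) {-pi..pi}"
proof (cases "k = 0")
  case True
  then show ?thesis
    using has_integral_const_real[of "1::complex" "-pi" pi] by (simp add: scaleR_conv_of_real)
next
  case False
  define E where "E = (\<lambda>y. exp (\<i> * of_int k * complex_of_real y) / (\<i> * of_int k))"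
  have "((\<lambda>y. exp (\<i> * of_int k * complex_of_real y)) has_integral (E pi - E (-pi))) {-pi..pi}"
  proof (rule fundamental_theorem_of_calculus)
    fix y :: real
    have "((\<lambda>w. exp (\<i> * of_int k * w) / (\<i> * of_int k)) has_field_derivative exp (\<i> * of_int k * complex_of_real y))
      (at (complex_of_real y))"
      using False by (auto intro!: derivative_eq_intros)
    from has_vector_derivative_real_field[OF this]
    show "(E has_vector_derivative exp (\<i> * of_int k * complex_of_real y)) (at y within {- pi..pi})"
      by (simp add: E_def)
  qed simp
  moreover have "exp (\<i> * of_int k * complex_of_real pi) = exp (\<i> * of_int k * complex_of_real (-pi))"
    by (subst exp_eq) (rule exI[of _ k], simp add: algebra_simps)
  ultimately show ?thesis
    using False by (simp add: E_def)
qed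

lemma has_integral_norm_square_trig_sum:
  fixes \<kappa> :: "'i \<Rightarrow> int"
  assumes "finite I" and inj: "inj_on \<kappa> I"
  shows "((\<lambda>y. (norm (\<Sum>n\<in>I. d n * exp (\<i> * of_int (\<kappa> n) * complex_of_real y)))\<^sup>2)
     has_integral (2 * pi * (\<Sum>n\<in>I. (norm (d n))\<^sup>2))) {-pi..pi}"
proof -
  let ?e = "\<lambda>k y. exp (\<i> * of_int k * complex_of_real y)"
  have *: "of_real ((norm (\<Sum>n\<in>I. d n * ?e (\<kappa> n) y))\<^sup>2) =
    (\<Sum>n\<in>I. \<Sum>m\<in>I. d n * cnj (d m) * ?e (\<kappa> n - \<kappa> m) y)" for y
  proof -
    have "d n * ?e (\<kappa> n) y * cnj (d m * ?e (\<kappa> m) y) = d n * cnj (d m) * ?e (\<kappa> n - \<kappa> m) y" for n m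
      by (simp add: exp_cnj algebra_simps exp_diff exp_minus divide_inverse)
    then show ?thesis
      by (simp only: complex_norm_square cnj_sum sum_product)
  qed
  have "((\<lambda>y. \<Sum>n\<in>I. \<Sum>m\<in>I. d n * cnj (d m) * ?e (\<kappa> n - \<kappa> m) y) has_integral
    (\<Sum>n\<in>I. \<Sum>m\<in>I. d n * cnj (d m) * (if \<kappa> n - \<kappa> m = 0 then 2 * pi else 0))) {-pi..pi}"
    by (intro has_integral_sum has_integral_mult_right has_integral_exp_int_period assms(1))
  moreover have "(\<Sum>n\<in>I. \<Sum>m\<in>I. d n * cnj (d m) * (if \<kappa> n - \<kappa> m = 0 then 2 * pi else 0))
    = of_real (2 * pi * (\<Sum>n\<in>I. (norm (d n))\<^sup>2))"
  proof -
    have "(\<Sum>m\<in>I. d n * cnj (d m) * (if \<kappa> n - \<kappa> m = 0 then 2 * pi else 0)) = of_real (2 * pi * (norm (d n))\<^sup>2)"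
      if n: "n \<in> I" for n
    proof -
      have "(\<Sum>m\<in>I. d n * cnj (d m) * (if \<kappa> n - \<kappa> m = 0 then 2 * pi else 0)) =
        (\<Sum>m\<in>I. if m = n then d n * cnj (d n) * (2 * pi) else 0)"
        using inj n by (intro sum.cong) (auto simp: inj_on_def)
      then show ?thesis
        using n assms(1) complex_norm_square[of "d n"] by simp
    qed
    then show ?thesis by (simp add: sum_distrib_left)
  qed
  ultimately have "((\<lambda>y. complex_of_real ((norm (\<Sum>n\<in>I. d n * ?e (\<kappa> n) y))\<^sup>2)) has_integral
    of_real (2 * pi * (\<Sum>n\<in>I. (norm (d n))\<^sup>2))) {-pi..pi}"
    by (simp only: *)
  from has_integral_Re[OF this] show ?thesis by simp
qed

text \<open>
  On each vertical segment this is Parseval's identity; the remaining integral of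
  \<open>exp (2 * \<kappa> n * x)\<close> is elementary. The exponent zero would contribute a term linear in \<open>b - a\<close> and is
  excluded, since a derivative \<open>(\<Psi> \<circ> exp)'\<close> has no constant term.
\<close>

lemma integral_norm_square_exp_sum:
  fixes \<kappa> :: "'i \<Rightarrow> int"
  assumes "finite I" and inj: "inj_on \<kappa> I" and nz: "\<And>n. n \<in> I \<Longrightarrow> \<kappa> n = 0 \<Longrightarrow> d n = 0" and ab: "a \<le> b"
  shows "integral (cbox (Complex a (-pi)) (Complex b pi)) (\<lambda>z. (norm (\<Sum>n\<in>I. d n * exp (of_int (\<kappa> n) * z)))\<^sup>2)
     = pi * (\<Sum>n\<in>I. (norm (d n))\<^sup>2 * (exp (2 * of_int (\<kappa> n) * b) - exp (2 * of_int (\<kappa> n) * a)) / of_int (\<kappa> n))"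
proof -
  have "integral {-pi..pi} (\<lambda>y. (norm (\<Sum>n\<in>I. d n * exp (of_int (\<kappa> n) * Complex x y)))\<^sup>2)
    = 2 * pi * (\<Sum>n\<in>I. (norm (d n))\<^sup>2 * exp (2 * of_int (\<kappa> n) * x))" for x
  proof -
    have "exp (of_int (\<kappa> n) * Complex x y) = of_real (exp (of_int (\<kappa> n) * x)) * exp (\<i> * of_int (\<kappa> n) * complex_of_real y)"
      for n y
      by (simp add: exp_of_real[symmetric] exp_add[symmetric] Complex_eq algebra_simps)
    then show ?thesis
      using integral_unique[OF has_integral_norm_square_trig_sum[OF assms(1,2),
        where d = "\<lambda>n. d n * of_real (exp (of_int (\<kappa> n) * x))"]]
      by (simp add: norm_mult power_mult_distrib exp_double mult.assoc)
  qed
  moreover have "((\<lambda>x. 2 * pi * (\<Sum>n\<in>I. (norm (d n))\<^sup>2 * exp (2 * of_int (\<kappa> n) * x))) has_integral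
    2 * pi * (\<Sum>n\<in>I. (norm (d n))\<^sup>2 * ((exp (2 * of_int (\<kappa> n) * b) - exp (2 * of_int (\<kappa> n) * a)) / (2 * of_int (\<kappa> n))))) {a..b}"
  proof (rule has_integral_mult_right, rule has_integral_sum[OF assms(1)])
    fix n assume n: "n \<in> I"
    show "((\<lambda>x. (norm (d n))\<^sup>2 * exp (2 * of_int (\<kappa> n) * x)) has_integral
      (norm (d n))\<^sup>2 * ((exp (2 * of_int (\<kappa> n) * b) - exp (2 * of_int (\<kappa> n) * a)) / (2 * of_int (\<kappa> n)))) {a..b}"
    proof (cases "\<kappa> n = 0")
      case True
      then show ?thesis using nz[OF n] by simp
    next
      case False
      have "((\<lambda>x. exp (2 * of_int (\<kappa> n) * x)) has_integral
        (exp (2 * of_int (\<kappa> n) * b) / (2 * of_int (\<kappa> n)) - exp (2 * of_int (\<kappa> n) * a) / (2 * of_int (\<kappa> n)))) {a..b}"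
        using False ab
        by (intro fundamental_theorem_of_calculus)
           (auto intro!: derivative_eq_intros simp flip: has_real_derivative_iff_has_vector_derivative)
      then show ?thesis
        by (intro has_integral_mult_right) (simp add: diff_divide_distrib)
    qed
  qed
  ultimately show ?thesis
    by (subst complex_box_integral(3))
       (auto intro!: continuous_intros simp: integral_unique sum_distrib_left mult.assoc intro: sum.cong)
qed

section \<open>A lower bound for the area of the image of an annulus\<close>

lemma power_series_derivative_times_arg:
  fixes b :: "nat \<Rightarrow> complex"
  assumes sm: "\<And>u. norm u < 1 \<Longrightarrow> summable (\<lambda>m. b m * u ^ m)" and u: "norm u < 1"
  shows "(\<lambda>m. of_nat m * b m * u ^ m) sums ((\<Sum>n. diffs b n * u ^ n) * u)"
proof -
  have "summable (\<lambda>n. diffs b n * u ^ n)"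
    using termdiff_converges[OF u sm] .
  from sums_mult2[OF diffs_equiv[OF this], of u]
  have "(\<lambda>n. of_nat n * b n * u ^ (n - Suc 0) * u) sums ((\<Sum>n. diffs b n * u ^ n) * u)" .
  also have "(\<lambda>n. of_nat n * b n * u ^ (n - Suc 0) * u) = (\<lambda>m. of_nat m * b m * u ^ m)"
    by (rule ext) (metis (no_types, lifting) One_nat_def bot_nat_0.not_eq_extremum mult.assoc
        mult_zero_left of_nat_0 power_minus_mult)
  finally show ?thesis .
qed

lemma exp_power_series_has_derivative:
  fixes b :: "nat \<Rightarrow> complex"
  assumes sm: "\<And>u. norm u < 1 \<Longrightarrow> summable (\<lambda>m. b m * u ^ m)" and z: "0 < Re z"
  shows "((\<lambda>z. exp z + (\<Sum>m. b m * exp (- z) ^ m)) has_field_derivative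
     exp z - (\<Sum>m. of_nat m * b m * exp (- z) ^ m)) (at z)"
proof -
  define u where "u = exp (- z)"
  have u: "norm u < 1" using z by (simp add: u_def)
  define k where "k = (norm u + 1) / 2"
  have "norm u < k" "k < 1" using u by (simp_all add: k_def)
  moreover from this have "0 < k" using norm_ge_zero le_less_trans by blast
  ultimately have k: "norm u < norm (of_real k :: complex)" "norm (of_real k :: complex) < 1"
    by simp_all
  have "DERIV (\<lambda>x. \<Sum>n. b n * x ^ n) (exp (- z)) :> (\<Sum>n. diffs b n * u ^ n)"
    unfolding u_def[symmetric] by (rule termdiffs_strong[OF sm[OF k(2)] k(1)])
  moreover have "((\<lambda>z. exp (- z)) has_field_derivative - u) (at z)"
    by (auto simp: u_def intro!: derivative_eq_intros)
  ultimately have "((\<lambda>z. \<Sum>n. b n * exp (- z) ^ n) has_field_derivative (\<Sum>n. diffs b n * u ^ n) * - u) (at z)"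
    by (rule DERIV_chain2[where f = "\<lambda>x. \<Sum>n. b n * x ^ n" and g = "\<lambda>z. exp (- z)"])
  then have "((\<lambda>z. \<Sum>n. b n * exp (- z) ^ n) has_field_derivative - ((\<Sum>n. diffs b n * u ^ n) * u)) (at z)"
    by simp
  then show ?thesis
    using sums_unique[OF power_series_derivative_times_arg[OF sm u]]
    by (auto simp: u_def intro!: derivative_eq_intros)
qed

text \<open>
  Composition with \<open>exp\<close> turns the annulus \<open>exp a < norm w < exp B\<close>, up to a slit, into a rectangle, and Laurent
  monomials into exponentials. The area is the integral of \<open>norm (deriv F z) ^ 2\<close>, and the partial sums of
  \<open>deriv F\<close> converge uniformly on the closed rectangle because \<open>a > 0\<close>. Their integrals increase with the number
  of terms, so that every truncation is a lower bound.
\<close>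

lemma area_exp_power_series:
  fixes F :: "complex \<Rightarrow> complex" and b :: "nat \<Rightarrow> complex"
  assumes ab: "0 < a" "a \<le> B"
    and inj: "inj_on F (box (Complex a (-pi)) (Complex B pi))"
    and sm: "\<And>u. norm u < 1 \<Longrightarrow> summable (\<lambda>m. b m * u ^ m)"
    and F: "\<And>z. 0 < Re z \<Longrightarrow> F z = exp z + (\<Sum>m. b m * exp (- z) ^ m)"
  shows "measure lebesgue (F ` box (Complex a (-pi)) (Complex B pi))
    \<ge> pi * (exp (2 * B) - exp (2 * a) + (\<Sum>m = 1..M. real m * (norm (b m))\<^sup>2 * (exp (- 2 * real m * a) - exp (- 2 * real m * B))))"
proof -
  let ?S = "box (Complex a (-pi)) (Complex B pi)" and ?Q = "cbox (Complex a (-pi)) (Complex B pi)"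
  define G where "G = (\<lambda>z. (norm (deriv F z))\<^sup>2)"
  have op: "open {z. 0 < Re z}"
    by (simp add: open_halfspace_Re_gt)
  have derF: "(F has_field_derivative exp z - (\<Sum>m. of_nat m * b m * exp (- z) ^ m)) (at z)"
    if "0 < Re z" for z
    using has_field_derivative_transform_within_open[OF exp_power_series_has_derivative[OF sm that] op] F that
    by auto
  then have hol: "F holomorphic_on {z. 0 < Re z}"
    using op by (auto simp: holomorphic_on_open)
  note der = DERIV_imp_deriv[OF derF]
  have QH: "?Q \<subseteq> {z. 0 < Re z}"
    using ab by (auto simp: in_cbox_complex_iff)
  have SQ: "?S \<subseteq> ?Q" by (rule box_subset_cbox)
  have contG: "continuous_on ?Q G"
    unfolding G_def using holomorphic_on_imp_continuous_on[OF holomorphic_deriv[OF hol op]] QH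
    by (intro continuous_intros) (rule continuous_on_subset)
  have "open (F ` ?S)"
    using hol QH SQ inj by (intro open_mapping_thm3) (auto intro: holomorphic_on_subset)
  have "measure lebesgue (F ` ?S) = (LINT z:?S|lborel. \<bar>(norm (deriv F z))\<^sup>2 - (norm (0::complex))\<^sup>2\<bar>)"
  proof (rule measure_complex_image_eq)
    show "?S \<in> sets borel" "F ` ?S \<in> sets borel"
      using \<open>open (F ` ?S)\<close> by simp_all
    show "inj_on F ?S" by (rule inj)
    show "set_integrable lborel ?S (\<lambda>z. \<bar>(norm (deriv F z))\<^sup>2 - (norm (0::complex))\<^sup>2\<bar>)"
      using complex_box_integral(1)[OF contG] by (simp add: G_def)
    fix z assume "z \<in> ?S"
    then have "z \<in> {z. 0 < Re z}" using SQ QH by blast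
    then have "(F has_field_derivative deriv F z) (at z within ?S)"
      using holomorphic_derivI[OF hol op] by (blast intro: has_field_derivative_at_within)
    then show "(F has_derivative (\<lambda>h. deriv F z * h + 0 * cnj h)) (at z within ?S)"
      by (simp add: has_field_derivative_def)
  qed
  also have "\<dots> = integral ?Q G"
    using complex_box_integral(2)[OF contG] by (simp add: G_def)
  finally have area: "measure lebesgue (F ` ?S) = integral ?Q G" .

  (* The leading exponential gets index 0, and the m-th term of the series gets index m + 1. *)
  define \<kappa> :: "nat \<Rightarrow> int" where "\<kappa> n = 1 - int n" for n
  define d :: "nat \<Rightarrow> complex" where "d n = (case n of 0 \<Rightarrow> 1 | Suc m \<Rightarrow> - (of_nat m * b m))" for n
  define P where "P N z = (\<Sum>n<Suc N. d n * exp (of_int (\<kappa> n) * z))" for N z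
  have P: "P N z = exp z - (\<Sum>m<N. of_nat m * b m * exp (- z) ^ m)" for N z
    unfolding P_def sum.lessThan_Suc_shift
    by (simp add: d_def \<kappa>_def sum_negf exp_of_nat_mult[symmetric])
  have ul: "uniform_limit ?Q P (deriv F) sequentially"
  proof -
    have "conv_radius (\<lambda>m. of_nat m * b m) \<ge> 1"
      by (rule conv_radius_geI_ex')
         (auto intro!: sums_summable[OF power_series_derivative_times_arg[OF sm]])
    then have r: "ereal (exp (- a)) < conv_radius (\<lambda>m. of_nat m * b m)"
      using ab less_le_trans[of "ereal (exp (- a))" 1] by simp
    have "uniform_limit ?Q (\<lambda>N z. \<Sum>m<N. of_nat m * b m * (exp (- z) - 0) ^ m)
       (\<lambda>z. \<Sum>m. of_nat m * b m * (exp (- z) - 0) ^ m) sequentially"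
      by (rule uniform_limit_compose'[OF powser_uniform_limit[OF r]])
         (auto simp: in_cbox_complex_iff)
    then have "uniform_limit ?Q (\<lambda>N z. exp z - (\<Sum>m<N. of_nat m * b m * exp (- z) ^ m))
       (\<lambda>z. exp z - (\<Sum>m. of_nat m * b m * exp (- z) ^ m)) sequentially"
      by (intro uniform_limit_intros) simp
    moreover have "deriv F z = exp z - (\<Sum>m. of_nat m * b m * exp (- z) ^ m)" if "z \<in> ?Q" for z
      using QH that by (intro der) auto
    ultimately show ?thesis
      by (subst uniform_limit_cong'[where g = "\<lambda>N z. exp z - (\<Sum>m<N. of_nat m * b m * exp (- z) ^ m)"
            and i = "\<lambda>z. exp z - (\<Sum>m. of_nat m * b m * exp (- z) ^ m)"]) (auto simp: P)
  qed
  have "uniform_limit ?Q (\<lambda>N z. (norm (P N z))\<^sup>2) G sequentially"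
    unfolding G_def power2_eq_square
  proof (rule uniform_lim_mult)
    show "uniform_limit ?Q (\<lambda>N z. norm (P N z)) (\<lambda>z. norm (deriv F z)) sequentially"
      by (rule uniform_limit_intros ul)+
    then show "uniform_limit ?Q (\<lambda>N z. norm (P N z)) (\<lambda>z. norm (deriv F z)) sequentially" .
    have "continuous_on ?Q (\<lambda>z. norm (deriv F z))"
      using holomorphic_on_imp_continuous_on[OF holomorphic_deriv[OF hol op]] QH
      by (intro continuous_intros) (rule continuous_on_subset)
    from compact_imp_bounded[OF compact_continuous_image[OF this compact_cbox]]
    show "bounded ((\<lambda>z. norm (deriv F z)) ` ?Q)" .
    then show "bounded ((\<lambda>z. norm (deriv F z)) ` ?Q)" .
  qed
  from this obtain I J where I: "\<And>N. ((\<lambda>z. (norm (P N z))\<^sup>2) has_integral I N) ?Q"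
    and J: "(G has_integral J) ?Q" and lim: "I \<longlonglongrightarrow> J"
  proof (rule uniform_limit_integral_cbox)
    show "continuous_on ?Q (\<lambda>z. (norm (P N z))\<^sup>2)" for N
      unfolding P_def by (intro continuous_intros)
  qed auto
  define T where "T m = real m * (norm (b m))\<^sup>2 * (exp (- 2 * real m * a) - exp (- 2 * real m * B))" for m
  have IN: "I N = pi * (exp (2 * B) - exp (2 * a) + (\<Sum>m<N. T m))" for N
  proof -
    have T: "(norm (d (Suc m)))\<^sup>2 * (exp (2 * of_int (\<kappa> (Suc m)) * B) - exp (2 * of_int (\<kappa> (Suc m)) * a)) / of_int (\<kappa> (Suc m)) = T m"
      for m
    proof (cases "m = 0")
      case False
      then show ?thesis
        by (simp add: d_def \<kappa>_def T_def norm_mult power_mult_distrib field_simps power2_eq_square)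
    qed (simp add: d_def T_def)
    have "I N = integral ?Q (\<lambda>z. (norm (P N z))\<^sup>2)"
      by (rule integral_unique[OF I, symmetric])
    also have "\<dots> = pi * (\<Sum>n<Suc N. (norm (d n))\<^sup>2 * (exp (2 * of_int (\<kappa> n) * B) - exp (2 * of_int (\<kappa> n) * a)) / of_int (\<kappa> n))"
      unfolding P_def
      by (rule integral_norm_square_exp_sum) (auto simp: inj_on_def \<kappa>_def d_def ab)
    also have "\<dots> = pi * (exp (2 * B) - exp (2 * a) + (\<Sum>m<N. T m))"
      unfolding sum.lessThan_Suc_shift T by (simp add: d_def \<kappa>_def)
    finally show ?thesis .
  qed
  have T0: "T m \<ge> 0" for m
    using ab by (auto simp: T_def intro!: mult_nonneg_nonneg mult_left_mono)
  have "eventually (\<lambda>N. pi * (exp (2 * B) - exp (2 * a) + (\<Sum>m = 1..M. T m)) \<le> I N) sequentially"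
    using eventually_gt_at_top[of M]
  proof eventually_elim
    case (elim N)
    then have "(\<Sum>m = 1..M. T m) \<le> (\<Sum>m<N. T m)"
      by (intro sum_mono2) (auto simp: T0)
    then show ?case by (simp add: IN)
  qed
  then have "pi * (exp (2 * B) - exp (2 * a) + (\<Sum>m = 1..M. T m)) \<le> J"
    by (rule tendsto_lowerbound[OF lim]) simp
  moreover have "J = integral ?Q G" using J by (simp add: integral_unique)
  ultimately show ?thesis by (simp add: area T_def)
qed

section \<open>Compactness of the Multibrot set\<close>

text \<open>
  Beyond radius 2 each step multiplies the modulus by at least \<open>q = norm (z n) - 1 > 1\<close>:
  \<open>r ^ j - norm c \<ge> r\<^sup>2 - r = r * (r - 1)\<close>.
\<close>

lemma multibrot_orbit_escape:
  assumes j: "2 \<le> j" and c: "norm c \<le> norm (multibrot_orbit j c n)" and n: "2 < norm (multibrot_orbit j c n)"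
  shows "\<not> bounded (range (multibrot_orbit j c))"
proof
  let ?z = "multibrot_orbit j c"
  assume "bounded (range ?z)"
  then obtain K where K: "\<And>k. norm (?z k) \<le> K"
    by (auto simp: bounded_iff)
  define q where "q = norm (?z n) - 1"
  have q: "1 < q" using n by (simp add: q_def)
  have "q ^ k * norm (?z n) \<le> norm (?z (n + k))" for k
  proof (induction k)
    case (Suc k)
    let ?r = "norm (?z (n + k))"
    have r: "norm (?z n) \<le> ?r"
      using Suc.IH one_le_power[of q k] q mult_right_mono[of 1 "q ^ k" "norm (?z n)"] by simp
    have "?r\<^sup>2 \<le> ?r ^ j"
      using r n j by (intro power_increasing) auto
    have "norm (?z (n + k) ^ j) - norm c \<le> norm (?z (n + k) ^ j + c)"
      using norm_diff_ineq by blast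
    then have "?r ^ j - norm c \<le> norm (?z (n + Suc k))"
      by (simp add: norm_power)
    then have "?r\<^sup>2 - ?r \<le> norm (?z (n + Suc k))"
      using \<open>?r\<^sup>2 \<le> ?r ^ j\<close> c r by linarith
    moreover have "q * ?r \<le> ?r\<^sup>2 - ?r"
      using mult_right_mono[OF r, of ?r] by (simp add: q_def power2_eq_square algebra_simps)
    moreover have "q * (q ^ k * norm (?z n)) \<le> q * ?r"
      using Suc.IH q by (intro mult_left_mono) auto
    ultimately show ?case by (simp add: mult.assoc)
  qed simp
  then have le: "q ^ k * norm (?z n) \<le> K" for k
    using K order_trans by blast
  obtain k where "K < q ^ k"
    using real_arch_pow[OF q] by blast
  moreover have "q ^ k * 1 \<le> q ^ k * norm (?z n)"
    using n q by (intro mult_left_mono) auto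
  ultimately show False using le[of k] by linarith
qed

lemma multibrot_eq:
  assumes "2 \<le> j"
  shows "multibrot j = (\<Inter>n. {c. norm (multibrot_orbit j c n) \<le> 2})"
proof (intro set_eqI iffI)
  fix c assume c: "c \<in> multibrot j"
  have 1: "multibrot_orbit j c (Suc 0) = c"
    using assms by (simp add: power_0_left)
  have "norm c \<le> 2"
    using multibrot_orbit_escape[OF assms, of c "Suc 0"] c unfolding 1 multibrot_def by force
  have "norm (multibrot_orbit j c n) \<le> 2" for n
  proof (rule ccontr)
    assume "\<not> norm (multibrot_orbit j c n) \<le> 2"
    then have "\<not> bounded (range (multibrot_orbit j c))"
      using \<open>norm c \<le> 2\<close> by (intro multibrot_orbit_escape[OF assms, of c n]) auto
    then show False using c by (simp add: multibrot_def)
  qed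
  then show "c \<in> (\<Inter>n. {c. norm (multibrot_orbit j c n) \<le> 2})" by simp
next
  fix c assume "c \<in> (\<Inter>n. {c. norm (multibrot_orbit j c n) \<le> 2})"
  then show "c \<in> multibrot j"
    by (auto simp: multibrot_def bounded_iff)
qed

lemma compact_multibrot:
  assumes "2 \<le> j"
  shows "compact (multibrot j)"
proof -
  have "continuous_on UNIV (\<lambda>c. multibrot_orbit j c n)" for n
    by (induction n) (auto intro!: continuous_intros)
  then have "closed {c. norm (multibrot_orbit j c n) \<le> 2}" for n
    by (intro closed_Collect_le continuous_intros)
  then have "closed (multibrot j)"
    unfolding multibrot_eq[OF assms] by auto
  moreover have "multibrot j \<subseteq> cball 0 2"
  proof
    fix c assume "c \<in> multibrot j"
    then have "norm (multibrot_orbit j c (Suc 0)) \<le> 2"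
      unfolding multibrot_eq[OF assms] by blast
    then show "c \<in> cball 0 2"
      using assms by (simp add: power_0_left)
  qed
  ultimately show ?thesis
    using bounded_cball bounded_subset compact_eq_bounded_closed by blast
qed

section \<open>The Laurent series on the whole exterior of the disc\<close>

text \<open>
  The expansion is only given near infinity. In the variable \<open>u = 1 / w\<close> the function \<open>\<Psi> w - w\<close> extends
  holomorphically to the unit disc, where its Taylor series converges everywhere; by uniqueness of the Taylor
  coefficients near 0, that series is the given one.
\<close>

lemma laurent_series_exterior:
  assumes hol: "\<Psi> holomorphic_on {w. 1 < norm w}"
    and lau: "laurent_coeffs_at_infinity \<Psi> b"
    and w: "1 < norm w"
  shows "(\<lambda>m. b m / w ^ m) sums (\<Psi> w - w)"
proof -
  obtain R where R: "\<And>w. R \<le> norm w \<Longrightarrow> (\<lambda>m. b m / w ^ m) sums (\<Psi> w - w)"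
    using lau by (auto simp: laurent_coeffs_at_infinity_def eventually_at_infinity)
  define R1 where "R1 = max R 2"
  define r where "r = 1 / R1"
  have r: "0 < r" "r < 1" "R1 * r = 1" "1 < R1" by (auto simp: r_def R1_def)
  define h where "h u = (if u = 0 then b 0 else \<Psi> (1 / u) - 1 / u)" for u
  have near: "(\<lambda>m. b m * u ^ m) sums h u" if "norm u < r" for u
  proof (cases "u = 0")
    case True
    then show ?thesis using powser_sums_zero[of b] by (simp add: h_def)
  next
    case False
    then have "R1 \<le> norm (1 / u)"
      using that r by (simp add: norm_divide field_simps r_def)
    then have "R \<le> norm (1 / u)" by (simp add: R1_def)
    from R[OF this] show ?thesis using False by (simp add: h_def divide_inverse power_inverse)
  qed
  have "h holomorphic_on ball 0 r"
    by (rule power_series_holomorphic[where a = b]) (use near in auto)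
  moreover have "h holomorphic_on (ball 0 1 - {0})"
  proof -
    have "(\<lambda>u. \<Psi> (1 / u) - 1 / u) holomorphic_on (ball 0 1 - {0})"
      by (intro holomorphic_intros holomorphic_on_compose_gen[OF _ hol, unfolded o_def])
         (auto simp: norm_divide field_simps)
    then show ?thesis
      by (rule holomorphic_transform) (auto simp: h_def)
  qed
  moreover have "ball 0 1 = ball 0 r \<union> (ball 0 1 - {0::complex})"
    using r by auto
  ultimately have hol_h: "h holomorphic_on ball 0 1"
    using holomorphic_on_Un[of h "ball 0 r" "ball 0 1 - {0}"] by (metis open_ball open_Diff finite.emptyI finite_insert finite_imp_closed)
  have "h has_fps_expansion Abs_fps b"
    using r near
    by (intro has_fps_expansionI) (auto simp: eventually_nhds_metric dist_norm intro!: exI[of _ r])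
  from has_fps_expansion_imp_sums_complex[OF this, of 1 "1 / w"]
  have "(\<lambda>m. b m * (1 / w) ^ m) sums h (1 / w)"
    using w hol_h by (simp add: norm_divide one_ereal_def eball_def ball_def dist_norm divide_simps)
  then show ?thesis
    using w by (auto simp: h_def divide_inverse power_inverse split: if_splits)
qed

section \<open>An upper bound for the area of the filled-in image\<close>

text \<open>
  On the circle \<open>norm w = R\<close> one has \<open>1 / w = cnj w / R\<^sup>2\<close>, so \<open>w + b 1 / w\<close> is there the real-linear map
  \<open>z + \<beta> * cnj z\<close> with \<open>\<beta> = b 1 / R\<^sup>2\<close>. This map takes discs to filled ellipses.
\<close>

lemma convex_compact_ellipse:
  fixes p \<beta> :: complex
  shows "convex ((\<lambda>z. p + (z + \<beta> * cnj z)) ` cball 0 \<rho>)" "compact ((\<lambda>z. p + (z + \<beta> * cnj z)) ` cball 0 \<rho>)"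
proof -
  have lin: "linear (\<lambda>z. z + \<beta> * cnj z)"
    by (rule linearI) (simp_all add: algebra_simps)
  have "convex ((+) p ` (\<lambda>z. z + \<beta> * cnj z) ` cball 0 \<rho>)"
    by (intro convex_translation convex_linear_image[OF lin] convex_cball)
  then show "convex ((\<lambda>z. p + (z + \<beta> * cnj z)) ` cball 0 \<rho>)" by (simp add: image_image)
  show "compact ((\<lambda>z. p + (z + \<beta> * cnj z)) ` cball 0 \<rho>)"
    by (intro compact_continuous_image continuous_intros compact_cball)
qed

text \<open>
  The inverse of \<open>z \<mapsto> z + \<beta> * cnj z\<close> has operator norm \<open>1 / (1 - norm \<beta>) \<le> 2\<close>. It transfers the error of the
  approximation of \<open>\<Psi>\<close> to the radius of the disc.
\<close>

lemma ellipse_solve: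
  fixes \<beta> e :: complex
  assumes "norm \<beta> \<le> 1 / 2"
  obtains z where "z + \<beta> * cnj z = e" "norm z \<le> 2 * norm e"
proof
  define q where "q = 1 - (norm \<beta>)\<^sup>2"
  have q: "q = (1 - norm \<beta>) * (1 + norm \<beta>)" by (simp add: q_def power2_eq_square algebra_simps)
  have q0: "q > 0" unfolding q using assms by (intro mult_pos_pos) (auto intro: add_pos_nonneg)
  define z where "z = (e - \<beta> * cnj e) / of_real q"
  have "\<beta> * cnj \<beta> = of_real ((norm \<beta>)\<^sup>2)" by (simp only: complex_norm_square)
  then have "e - \<beta> * cnj e + \<beta> * cnj (e - \<beta> * cnj e) = e * of_real q"
    by (simp add: q_def algebra_simps)
  then show "z + \<beta> * cnj z = e"
    using q0 by (simp add: z_def add_divide_distrib[symmetric])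
  have "norm (e - \<beta> * cnj e) \<le> (1 + norm \<beta>) * norm e"
    using norm_triangle_ineq4[of e "\<beta> * cnj e"] by (simp add: norm_mult algebra_simps)
  then have "norm z \<le> (1 + norm \<beta>) * norm e / q"
    using q0 by (simp add: z_def norm_divide divide_right_mono)
  also have "\<dots> = norm e / (1 - norm \<beta>)"
    using q0 unfolding q by (simp add: add_nonneg_eq_0_iff)
  also have "\<dots> \<le> norm e / (1 / 2)"
    using assms by (intro divide_left_mono) auto
  finally show "norm z \<le> 2 * norm e" by simp
qed

lemma measure_ellipse:
  fixes p \<beta> :: complex
  assumes \<beta>: "norm \<beta> \<le> 1 / 2" and \<rho>: "0 \<le> \<rho>"
  shows "measure lebesgue ((\<lambda>z. p + (z + \<beta> * cnj z)) ` cball 0 \<rho>) = (1 - (norm \<beta>)\<^sup>2) * (pi * \<rho>\<^sup>2)"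
proof -
  let ?f = "\<lambda>z. p + (z + \<beta> * cnj z)"
  have le: "(norm \<beta>)\<^sup>2 \<le> 1"
    using power_le_one[of "norm \<beta>" 2] \<beta> by simp
  have "measure lebesgue (?f ` cball 0 \<rho>) = (LINT z:cball (0::complex) \<rho>|lborel. \<bar>(norm (1::complex))\<^sup>2 - (norm \<beta>)\<^sup>2\<bar>)"
  proof (rule measure_complex_image_eq[where a = "\<lambda>_. 1" and c = "\<lambda>_. \<beta>"])
    show "?f ` cball 0 \<rho> \<in> sets borel"
      using convex_compact_ellipse(2) borel_compact by blast
    show "(?f has_derivative (\<lambda>h. 1 * h + \<beta> * cnj h)) (at z within cball 0 \<rho>)" for z
      by (auto intro!: derivative_eq_intros)
    show "inj_on ?f (cball 0 \<rho>)"
    proof (rule inj_onI)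
      fix z w assume "?f z = ?f w"
      then have "z - w = - (\<beta> * cnj (z - w))" by (simp add: algebra_simps)
      then have "norm (z - w) = norm \<beta> * norm (z - w)"
        by (metis complex_mod_cnj norm_minus_cancel norm_mult)
      then show "z = w" using \<beta> by auto
    qed
    show "set_integrable lborel (cball (0::complex) \<rho>) (\<lambda>z. \<bar>(norm (1::complex))\<^sup>2 - (norm \<beta>)\<^sup>2\<bar>)"
      using borel_integrable_compact[of "cball 0 \<rho> :: complex set" "\<lambda>z. \<bar>(norm (1::complex))\<^sup>2 - (norm \<beta>)\<^sup>2\<bar>"]
      by (simp add: set_integrable_def)
  qed simp
  also have "\<dots> = (1 - (norm \<beta>)\<^sup>2) * measure lborel (cball (0::complex) \<rho>)"
    using le emeasure_bounded_finite[of "cball (0::complex) \<rho>"]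
    by (simp add: set_lebesgue_integral_def)
  also have "measure lborel (cball (0::complex) \<rho>) = pi * \<rho>\<^sup>2"
    using content_cball[OF \<rho>, of "0::complex"] by (simp add: unit_ball_vol_2)
  finally show ?thesis .
qed

text \<open>
  The term \<open>b 1 / w\<close> has to be kept: an error \<open>O(1 / R)\<close> in the position of the curve would give an error \<open>O(1)\<close> in
  the area, whereas \<open>O(1 / R\<^sup>2)\<close> gives \<open>O(1 / R)\<close>.
\<close>

lemma exterior_asymptotics:
  fixes b :: "nat \<Rightarrow> complex"
  assumes lau: "\<And>w. 1 < norm w \<Longrightarrow> (\<lambda>m. b m / w ^ m) sums (\<Psi> w - w)"
  obtains C where "0 \<le> C"
    "\<And>w. 2 \<le> norm w \<Longrightarrow> norm (\<Psi> w - (w + b 0 + b 1 / w)) \<le> C / (norm w)\<^sup>2"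
proof -
  define g where "g u = (\<Sum>m. b (m + 2) * u ^ m)" for u
  have s: "(\<lambda>m. b (m + 2) / w ^ (m + 2)) sums (\<Psi> w - (w + b 0 + b 1 / w))" if "1 < norm w" for w
    using sums_split_initial_segment[OF lau[OF that], of 2]
    by (simp add: numeral_2_eq_2 algebra_simps)
  have sg: "(\<lambda>m. b (m + 2) * (1 / w) ^ m) sums ((\<Psi> w - (w + b 0 + b 1 / w)) * w\<^sup>2)" if "1 < norm w" for w
  proof -
    have "w \<noteq> 0" using that by auto
    then have "(\<lambda>m. b (m + 2) / w ^ (m + 2) * w\<^sup>2) = (\<lambda>m. b (m + 2) * (1 / w) ^ m)"
      by (simp add: power_add power_divide power2_eq_square)
    then show ?thesis using sums_mult2[OF s[OF that], of "w\<^sup>2"] by simp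
  qed
  have "ereal (1 / 2) < conv_radius (\<lambda>m. b (m + 2))"
  proof -
    have "ereal (norm (2 / 3 :: complex)) \<le> conv_radius (\<lambda>m. b (m + 2))"
      using sums_summable[OF sg[of "3 / 2"]] by (intro conv_radius_geI) simp
    then show ?thesis by (rule less_le_trans[rotated]) simp
  qed
  from powser_continuous_suminf[OF this, of 0]
  have "continuous_on (cball 0 (1 / 2)) g" by (simp add: g_def[abs_def])
  from compact_imp_bounded[OF compact_continuous_image[OF this compact_cball]]
  obtain C where C: "0 < C" "\<And>u. norm u \<le> 1 / 2 \<Longrightarrow> norm (g u) \<le> C"
    by (auto simp: bounded_pos)
  show thesis
  proof
    show "0 \<le> C" using C by simp
    fix w :: complex assume w: "2 \<le> norm w"
    then have "g (1 / w) = (\<Psi> w - (w + b 0 + b 1 / w)) * w\<^sup>2"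
      using sg[of w] by (simp add: g_def sums_iff)
    moreover have "norm (g (1 / w)) \<le> C"
      using w by (intro C(2)) (auto simp: norm_divide divide_simps)
    ultimately have "norm (\<Psi> w - (w + b 0 + b 1 / w)) * (norm w)\<^sup>2 \<le> C"
      by (simp add: norm_mult norm_power)
    moreover have "0 < (norm w)\<^sup>2" using w by (intro zero_less_power) linarith
    ultimately show "norm (\<Psi> w - (w + b 0 + b 1 / w)) \<le> C / (norm w)\<^sup>2"
      by (simp add: pos_le_divide_eq)
  qed
qed

text \<open>
  What the image curve of the circle encloses lies in any convex compact set containing the curve:
  the complement of \<open>E\<close> is connected and avoids the curve, hence it lies either in the
  image of \<open>R < norm w\<close> or outside the image of \<open>R \<le> norm w\<close>, and it meets the former, which is unbounded.
\<close>

lemma complement_exterior_image_subset: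
  fixes \<Psi> :: "complex \<Rightarrow> complex"
  assumes hol: "\<Psi> holomorphic_on {w. 1 < norm w}" and inj: "inj_on \<Psi> {w. 1 < norm w}"
    and bd: "\<And>w. R \<le> norm w \<Longrightarrow> norm (\<Psi> w - w) \<le> C" and R: "1 < R"
    and E: "convex E" "compact E" and circ: "\<And>w. norm w = R \<Longrightarrow> \<Psi> w \<in> E"
  shows "- (\<Psi> ` {w. R \<le> norm w}) \<subseteq> E"
proof -
  let ?V = "\<Psi> ` {w. R < norm w}" and ?W = "\<Psi> ` {w. R \<le> norm w}"
  have opD: "open {w::complex. r < norm w}" for r
    by (intro open_Collect_less continuous_intros)
  have "open ?V"
    using R by (intro open_mapping_thm3 holomorphic_on_subset[OF hol] inj_on_subset[OF inj] opD) auto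
  (* Preimages of a convergent sequence stay bounded, since the map moves points by at most C. *)

  have "closed ?W"
    unfolding closed_sequential_limits
  proof (intro allI impI, elim conjE)
    fix x l assume x: "\<forall>n. x n \<in> ?W" and lim: "x \<longlonglongrightarrow> l"
    from x obtain w where w: "\<And>n. x n = \<Psi> (w n)" "\<And>n. R \<le> norm (w n)"
      by (auto simp: image_iff) metis
    obtain X where X: "\<And>n. norm (x n) \<le> X"
      using convergent_imp_bounded[OF lim] by (auto simp: bounded_iff)
    have "norm (w n) \<le> X + C" for n
      using bd[OF w(2)[of n]] X[of n] norm_triangle_ineq2[of "w n" "\<Psi> (w n)"]
      by (simp add: w(1) norm_minus_commute)
    then have "bounded (range w)" by (auto simp: bounded_iff)
    then obtain v r where r: "strict_mono r" "(w \<circ> r) \<longlonglongrightarrow> v"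
      using bounded_imp_convergent_subsequence by blast
    have v: "R \<le> norm v"
      by (rule tendsto_lowerbound[OF tendsto_norm[OF r(2)]]) (auto simp: w)
    then have "isCont \<Psi> v"
      using holomorphic_on_imp_continuous_on[OF hol] R continuous_on_eq_continuous_at[OF opD[of 1], of \<Psi>] by auto
    from isCont_tendsto_compose[OF this r(2)] have "(x \<circ> r) \<longlonglongrightarrow> \<Psi> v"
      by (simp add: o_def w(1)[symmetric])
    moreover have "(x \<circ> r) \<longlonglongrightarrow> l" using lim r(1) by (rule LIMSEQ_subseq_LIMSEQ)
    ultimately show "l \<in> ?W" using LIMSEQ_unique v by blast
  qed
  have conn: "connected (- E)"
    using E by (intro connected_complement_bounded_convex) (auto simp: compact_imp_bounded)
  have "?V \<inter> - E = {} \<or> - ?W \<inter> - E = {}"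
  proof (rule connectedD[OF conn \<open>open ?V\<close>])
    show "open (- ?W)" using \<open>closed ?W\<close> by auto
    show "?V \<inter> - ?W \<inter> - E = {}" by auto
    show "- E \<subseteq> ?V \<union> - ?W"
    proof
      fix x assume "x \<in> - E"
      then show "x \<in> ?V \<union> - ?W"
        using circ by (auto simp: image_iff) (metis order_le_less)
    qed
  qed
  moreover have "?V \<inter> - E \<noteq> {}"
  proof
    assume "?V \<inter> - E = {}"
    moreover obtain B where B: "\<And>x. x \<in> E \<Longrightarrow> norm x \<le> B"
      using compact_imp_bounded[OF E(2)] by (auto simp: bounded_iff)
    ultimately have V: "norm (\<Psi> w) \<le> B" if "R < norm w" for w
      using that by auto
    define w :: complex where "w = of_real (max (R + 1) (B + C + 1))"
    have w: "R < norm w" "B + C + 1 \<le> norm w" using R by (auto simp: w_def)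
    then show False
      using V[OF w(1)] bd[of w] norm_triangle_ineq2[of w "\<Psi> w"] by (simp add: norm_minus_commute)
  qed
  ultimately show ?thesis by auto
qed

section \<open>The area theorem\<close>

text \<open>
  The set \<open>K\<close> and the image of the annulus \<open>exp a < norm w < R\<close> are disjoint subsets of the ellipse with
  parameter \<open>\<beta> = b 1 / R\<^sup>2\<close> on the disc of radius \<open>R + 2 * C / R\<^sup>2\<close>. The determinant \<open>1 - (norm \<beta>)\<^sup>2\<close> of the
  ellipse map differs from 1 by \<open>O(1 / R ^ 4)\<close>, so bounding it by 1 costs nothing in the limit.
\<close>

lemma exterior_area_inequality:
  fixes \<Psi> :: "complex \<Rightarrow> complex" and b :: "nat \<Rightarrow> complex"
  assumes K: "compact K" and hol: "\<Psi> holomorphic_on {w. 1 < norm w}"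
    and inj: "inj_on \<Psi> {w. 1 < norm w}" and img: "\<Psi> ` {w. 1 < norm w} = - K"
    and lau: "\<And>w. 1 < norm w \<Longrightarrow> (\<lambda>m. b m / w ^ m) sums (\<Psi> w - w)"
    and C: "0 \<le> C" "\<And>w. 2 \<le> norm w \<Longrightarrow> norm (\<Psi> w - (w + b 0 + b 1 / w)) \<le> C / (norm w)\<^sup>2"
    and R: "2 \<le> R" "2 * norm (b 1) \<le> R\<^sup>2" and a: "0 < a" "a \<le> ln R"
  shows "measure lebesgue K + pi * (R\<^sup>2 - exp (2 * a)
     + (\<Sum>m = 1..M. real m * (norm (b m))\<^sup>2 * (exp (- 2 * real m * a) - (1 / R) ^ (2 * m))))
     \<le> pi * (R + 2 * C / R\<^sup>2)\<^sup>2"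
proof -
  define B where "B = ln R"
  have R0: "0 < R" using R by simp
  have expB: "exp B = R" using R0 by (simp add: B_def)
  define F where "F z = \<Psi> (exp z)" for z
  let ?S = "box (Complex a (-pi)) (Complex B pi)"
  define \<beta> where "\<beta> = b 1 / of_real (R\<^sup>2)"
  define \<rho> where "\<rho> = R + 2 * C / R\<^sup>2"
  define E where "E = (\<lambda>z. b 0 + (z + \<beta> * cnj z)) ` cball 0 \<rho>"
  have \<beta>: "norm \<beta> \<le> 1 / 2"
    using R R0 by (simp add: \<beta>_def norm_divide norm_power divide_simps)
  have \<rho>: "0 \<le> \<rho>" using R0 C by (simp add: \<rho>_def)
  have E: "convex E" "compact E"
    unfolding E_def by (rule convex_compact_ellipse)+
  have circ: "\<Psi> w \<in> E" if w: "norm w = R" for w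
  proof -
    have "w \<noteq> 0" using w R0 by auto
    have "of_real (R\<^sup>2) = w * cnj w"
      using w complex_norm_square[of w] by simp
    then have bw: "b 1 / w = \<beta> * cnj w"
      using \<open>w \<noteq> 0\<close> by (simp add: \<beta>_def)
    obtain z where z: "z + \<beta> * cnj z = \<Psi> w - (w + b 0 + b 1 / w)"
      "norm z \<le> 2 * norm (\<Psi> w - (w + b 0 + b 1 / w))"
      using ellipse_solve[OF \<beta>] by blast
    have "norm z \<le> 2 * (C / R\<^sup>2)"
      using z(2) C(2)[of w] w R by simp
    then have "norm (w + z) \<le> \<rho>"
      using norm_triangle_ineq[of w z] w by (simp add: \<rho>_def)
    moreover have "\<Psi> w = b 0 + ((w + z) + \<beta> * cnj (w + z))"
      using z(1) unfolding bw by (simp add: algebra_simps)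
    ultimately show ?thesis unfolding E_def by (intro image_eqI[of _ _ "w + z"]) auto
  qed
  have near: "norm (\<Psi> w - w) \<le> norm (b 0) + norm (b 1) + C" if w: "R \<le> norm w" for w
  proof -
    have 1: "1 \<le> norm w" "2 \<le> norm w" using w R by auto
    have "norm (\<Psi> w - w) \<le> norm (\<Psi> w - (w + b 0 + b 1 / w)) + norm (b 0 + b 1 / w)"
      using norm_triangle_ineq[of "\<Psi> w - (w + b 0 + b 1 / w)" "b 0 + b 1 / w"] by simp
    moreover have "norm (b 0 + b 1 / w) \<le> norm (b 0) + norm (b 1) / norm w"
      using norm_triangle_ineq[of "b 0" "b 1 / w"] by (simp add: norm_divide)
    moreover have "norm (b 1) / norm w \<le> norm (b 1) / 1"
      using 1 by (intro divide_left_mono) auto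
    moreover have "C / (norm w)\<^sup>2 \<le> C / 1"
      using 1 C(1) one_le_power[OF 1(1), of 2] by (intro divide_left_mono) auto
    ultimately show ?thesis using C(2)[OF 1(2)] by simp
  qed
  have sub: "- (\<Psi> ` {w. R \<le> norm w}) \<subseteq> E"
    using R by (intro complement_exterior_image_subset[OF hol inj near _ E circ]) auto
  have S: "1 < norm (exp z)" "norm (exp z) < R" "- pi < Im z" "Im z < pi" if "z \<in> ?S" for z
    using that a expB exp_less_mono[of "Re z" B] by (auto simp: in_box_complex_iff)
  have injF: "inj_on F ?S"
  proof (rule inj_onI)
    fix z w assume zw: "z \<in> ?S" "w \<in> ?S" "F z = F w"
    then have "exp z = exp w"
      using inj_onD[OF inj] S(1) unfolding F_def by blast
    then have "Ln (exp z) = Ln (exp w)" by simp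
    then show "z = w" using S(3,4)[OF zw(1)] S(3,4)[OF zw(2)] by simp
  qed
  have Fser: "(\<lambda>m. b m * u ^ m) sums (\<Psi> (1 / u) - 1 / u)" if "norm u < 1" "u \<noteq> 0" for u
    using lau[of "1 / u"] that by (simp add: norm_divide divide_simps power_divide)
  have sm: "summable (\<lambda>m. b m * u ^ m)" if "norm u < 1" for u
    using Fser[OF that] by (cases "u = 0") (auto simp: sums_iff intro: sums_summable[OF powser_sums_zero])
  have FK: "F ` ?S \<subseteq> \<Psi> ` {w. 1 < norm w} - \<Psi> ` {w. R \<le> norm w}"
  proof
    fix y assume "y \<in> F ` ?S"
    then obtain z where z: "z \<in> ?S" "y = \<Psi> (exp z)" by (auto simp: F_def)
    have "y \<noteq> \<Psi> w" if "R \<le> norm w" for w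
      using inj_onD[OF inj, of "exp z" w] that S[OF z(1)] R z(2) by auto
    then show "y \<in> \<Psi> ` {w. 1 < norm w} - \<Psi> ` {w. R \<le> norm w}"
      using z S by auto
  qed
  have "F ` ?S \<subseteq> E" using FK sub by blast
  have "K \<subseteq> - (\<Psi> ` {w. R \<le> norm w})"
  proof -
    have "\<Psi> ` {w. R \<le> norm w} \<subseteq> \<Psi> ` {w. 1 < norm w}" using R by auto
    then show ?thesis using img by blast
  qed
  then have "K \<subseteq> E" using sub by blast
  have disj: "K \<inter> F ` ?S = {}" using FK img by blast
  have opF: "open (F ` ?S)"
  proof -
    have "F holomorphic_on ?S"
      unfolding F_def[abs_def]
      by (rule holomorphic_on_compose_gen[OF _ hol, unfolded o_def]) (use S(1) in \<open>auto intro!: holomorphic_intros\<close>)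
    then show ?thesis using injF by (intro open_mapping_thm3) auto
  qed
  have Efm: "E \<in> lmeasurable" using E(2) by (rule lmeasurable_compact)
  have Kfm: "K \<in> lmeasurable" using K by (rule lmeasurable_compact)
  have Ffm: "F ` ?S \<in> lmeasurable"
    using opF \<open>F ` ?S \<subseteq> E\<close> compact_imp_bounded[OF E(2)] bounded_subset by (intro lmeasurable_open) auto
  have "measure lebesgue K + measure lebesgue (F ` ?S) = measure lebesgue (K \<union> F ` ?S)"
    using measure_Un2[OF Kfm Ffm] disj by (simp add: Diff_triv Int_commute)
  also have "\<dots> \<le> measure lebesgue E"
    using Efm Kfm Ffm \<open>K \<subseteq> E\<close> \<open>F ` ?S \<subseteq> E\<close>
    by (intro measure_mono_fmeasurable) (auto simp: fmeasurableD)
  also have "\<dots> = (1 - (norm \<beta>)\<^sup>2) * (pi * \<rho>\<^sup>2)"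
    unfolding E_def by (rule measure_ellipse[OF \<beta> \<rho>])
  also have "\<dots> \<le> 1 * (pi * \<rho>\<^sup>2)"
    by (intro mult_right_mono) auto
  finally have up: "measure lebesgue K + measure lebesgue (F ` ?S) \<le> pi * \<rho>\<^sup>2" by simp
  have "pi * (exp (2 * B) - exp (2 * a) + (\<Sum>m = 1..M. real m * (norm (b m))\<^sup>2 * (exp (- 2 * real m * a) - exp (- 2 * real m * B))))
    \<le> measure lebesgue (F ` ?S)"
  proof (rule area_exp_power_series[OF a(1) _ injF sm])
    show "a \<le> B" using a by (simp add: B_def)
    fix z assume "0 < Re z"
    then have "norm (exp (- z)) < 1" by simp
    from Fser[OF this] show "F z = exp z + (\<Sum>m. b m * exp (- z) ^ m)"
      by (simp add: sums_iff F_def exp_minus field_simps)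
  qed
  moreover have "exp (2 * B) = R\<^sup>2"
    using expB by (simp add: exp_double)
  moreover have "exp (- 2 * real m * B) = (1 / R) ^ (2 * m)" for m
  proof -
    have "exp (- 2 * real m * B) = inverse (exp (real (2 * m) * B))"
      by (simp add: exp_minus[symmetric])
    also have "\<dots> = inverse (exp B ^ (2 * m))" by (simp only: exp_of_nat_mult)
    finally show ?thesis by (simp add: expB inverse_eq_divide power_one_over)
  qed
  ultimately show ?thesis using up by (simp add: \<rho>_def)
qed

text \<open>
  Gronwall's area theorem with a truncated sum. Letting \<open>a\<close> tend to 0 and then \<open>R\<close> to infinity, the terms
  \<open>R\<^sup>2\<close> cancel. The second limit is taken in \<open>q = 1 / R\<close>, in which the bound \<open>f\<close> is a polynomial.
\<close>

theorem exterior_area_theorem: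
  fixes \<Psi> :: "complex \<Rightarrow> complex" and b :: "nat \<Rightarrow> complex"
  assumes K: "compact K" and hol: "\<Psi> holomorphic_on {w. 1 < norm w}"
    and inj: "inj_on \<Psi> {w. 1 < norm w}" and img: "\<Psi> ` {w. 1 < norm w} = - K"
    and lau: "\<And>w. 1 < norm w \<Longrightarrow> (\<lambda>m. b m / w ^ m) sums (\<Psi> w - w)"
  shows "measure lebesgue K \<le> pi * (1 - (\<Sum>m = 1..M. real m * (norm (b m))\<^sup>2))"
proof -
  obtain C where C: "0 \<le> C"
    "\<And>w. 2 \<le> norm w \<Longrightarrow> norm (\<Psi> w - (w + b 0 + b 1 / w)) \<le> C / (norm w)\<^sup>2"
    using exterior_asymptotics[OF lau] by blast
  let ?\<mu> = "measure lebesgue K"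
  let ?c = "\<lambda>m. real m * (norm (b m))\<^sup>2"
  define f where "f q = pi * (4 * C * q + 4 * C\<^sup>2 * q ^ 4) + pi * (1 - (\<Sum>m = 1..M. ?c m * (1 - q ^ (2 * m))))" for q :: real
  have bound: "?\<mu> \<le> f (1 / R)" if R: "2 \<le> R" "2 * norm (b 1) \<le> R\<^sup>2" for R
  proof -
    let ?L = "\<lambda>a. ?\<mu> + pi * (R\<^sup>2 - exp (2 * a) + (\<Sum>m = 1..M. ?c m * (exp (- 2 * real m * a) - (1 / R) ^ (2 * m))))"
    have "(?L \<longlongrightarrow> ?L 0) (at_right 0)"
      by (intro tendsto_intros)
    moreover have "eventually (\<lambda>a. ?L a \<le> pi * (R + 2 * C / R\<^sup>2)\<^sup>2) (at_right 0)"
    proof -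
      have "eventually (\<lambda>a. a \<in> {0<..<ln R}) (at_right (0::real))"
        using R by (intro eventually_at_right_real) auto
      then show ?thesis
        by eventually_elim (intro exterior_area_inequality[OF K hol inj img lau C R]; simp)
    qed
    ultimately have "?L 0 \<le> pi * (R + 2 * C / R\<^sup>2)\<^sup>2"
      by (intro tendsto_upperbound[of ?L "?L 0" "at_right 0"]) auto
    moreover have "(R + 2 * C / R\<^sup>2)\<^sup>2 = R\<^sup>2 + (4 * C * (1 / R) + 4 * C\<^sup>2 * (1 / R) ^ 4)"
      using R by (simp add: power2_eq_square field_simps eval_nat_numeral)
    ultimately show ?thesis
      by (simp add: f_def algebra_simps)
  qed
  have "(f \<longlongrightarrow> f 0) (at_right 0)"
    unfolding f_def by (intro tendsto_intros)
  moreover have "eventually (\<lambda>q. ?\<mu> \<le> f q) (at_right 0)"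
  proof -
    define q0 where "q0 = 1 / (2 + 2 * norm (b 1))"
    have "0 < q0" by (auto simp: q0_def intro!: divide_pos_pos add_pos_nonneg)
    then have "eventually (\<lambda>q. q \<in> {0<..<q0}) (at_right (0::real))"
      by (rule eventually_at_right_real)
    then show ?thesis
    proof eventually_elim
      case (elim q)
      define R where "R = 1 / q"
      have q: "0 < q" "q < q0" using elim by auto
      have "1 / q0 \<le> R" unfolding R_def using q by (intro divide_left_mono) auto
      then have R: "2 + 2 * norm (b 1) \<le> R" by (simp add: q0_def)
      then have "1 \<le> R" by (smt (verit) norm_ge_zero)
      then have "R \<le> R\<^sup>2" by (simp add: power2_eq_square)
      moreover have "2 \<le> R" using R by (smt (verit) norm_ge_zero)
      ultimately have "?\<mu> \<le> f (1 / R)" using R by (intro bound) auto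
      then show ?case by (simp add: R_def)
    qed
  qed
  ultimately have "?\<mu> \<le> f 0"
    by (intro tendsto_lowerbound[of f "f 0" "at_right 0"]) auto
  also have "f 0 = pi * (1 - (\<Sum>m = 1..M. ?c m))"
  proof -
    have "(\<Sum>m = 1..M. ?c m * (1 - 0 ^ (2 * m))) = (\<Sum>m = 1..M. ?c m)"
      by (intro sum.cong) (auto simp: power_0_left)
    then show ?thesis by (simp add: f_def)
  qed
  finally show ?thesis .
qed

section \<open>The bound for Multibrot sets\<close>

theorem mainTheorem2:
  fixes j M :: nat and \<Phi> \<Psi> :: "complex \<Rightarrow> complex" and b :: "nat \<Rightarrow> complex"
  assumes "j \<ge> 2"
    and "normalized_exterior_map j \<Phi>"
    and "\<Psi> = inv_into (- multibrot j) \<Phi>"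
    and "laurent_coeffs_at_infinity \<Psi> b"
    and "M \<ge> 1"
  shows "measure lebesgue (multibrot j) \<le> pi * (1 - (\<Sum>m = 1..M. real m * (norm (b m))\<^sup>2))"
proof -
  let ?U = "- multibrot j" and ?D = "{w::complex. 1 < norm w}"
  have cpt: "compact (multibrot j)" by (rule compact_multibrot[OF assms(1)])
  then have opU: "open ?U" by (simp add: compact_imp_closed open_Compl)
  have hol\<Phi>: "\<Phi> holomorphic_on ?U" and bij: "bij_betw \<Phi> ?U ?D"
    using assms(2) by (auto simp: normalized_exterior_map_def)
  have bij\<Psi>: "bij_betw \<Psi> ?D ?U"
    unfolding assms(3) by (rule bij_betw_inv_into[OF bij])
  have hol: "\<Psi> holomorphic_on ?D"
  proof -
    obtain g where g: "g holomorphic_on \<Phi> ` ?U" "\<And>z. z \<in> ?U \<Longrightarrow> g (\<Phi> z) = z"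
      using holomorphic_has_inverse[OF hol\<Phi> opU] bij by (metis bij_betw_def)
    have im: "\<Phi> ` ?U = ?D" using bij by (simp add: bij_betw_def)
    show ?thesis
    proof (rule holomorphic_transform)
      show "g holomorphic_on ?D" using g(1) im by simp
      fix w assume "w \<in> ?D"
      then obtain z where z: "z \<in> ?U" "w = \<Phi> z" using im by blast
      then show "g w = \<Psi> w"
        using g(2) inv_into_f_f[of \<Phi> ?U z] bij by (simp add: assms(3) bij_betw_def)
    qed
  qed
  show ?thesis
    using bij\<Psi> laurent_series_exterior[OF hol assms(4)]
    by (intro exterior_area_theorem[OF cpt hol]) (auto simp: bij_betw_def)
qed

end
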